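(* Let $R$ be a commutative $\mathbb{Q}$-algebra and $t\in\Omega_R$. The maps $\kappa_n^t:\mathcal{U}(HR)\to R$ ($n\ge1$) have the following properties. (i) For every $n\ge1$, $\kappa_n^t(f)$ is a polynomial (with coefficients in $R$, independent of $f$) in $p_1^H(f),\dots,p_n^H(f)$ whose $p_n^H$-term is $\frac{t^{n-1}}{(t)_{\underline{n}}}\,p_n^H(f)$ (all remaining terms involve only $p_1^H(f),\dots,p_{n-1}^H(f)$). (ii) $\kappa_n^t(D_rf)=r^n\kappa_n^t(f)$ for all $r\in R$ and $f\in\mathcal{U}(HR)$. (iii) $\kappa_n^t(f\boxplus^H_t g)=\kappa_n^t(f)+\kappa_n^t(g)$ for all $f,g\in\mathcal{U}(HR)$. Moreover, among homogeneous polynomial functionals satisfying additivity, the leading term determines $\kappa_n^t$ uniquely: if $\varphi:\mathcal{U}(HR)\to R$ is given by a polynomial over $R$ in $p_1^H(f),\dots,p_n^H(f)$ whose $p_n^H$-term is $\frac{t^{n-1}}{(t)_{\underline{n}}}p_n^H(f)$, and $\varphi$ satisfies $\varphi(D_rf)=r^n\varphi(f)$ and $\varphi(f\boxplus^H_tg)=\varphi(f)+\varphi(g)$ for all $r\in R$, $f,g\in\mathcal{U}(HR)$, then $\varphi=\kappa_n^t$. The same assertions hold for $t=d$, $d\in\mathbb{Z}_{\ge1}$, on $\mathcal{U}_d(HR)$, for the maps $\kappa_n^d:\mathcal{U}_d(HR)\to R$ with $1\le n\le d$ and the truncated product $\boxplus^H_d$.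
   Context: $\mathbb{N}=\{0,1,2,\dots\}$. $HR$ is the set of all maps $f:\mathbb{N}\to R$. For $a\in R$: $(a)_{\underline{0}}=1$, $(a)_{\underline{n}}=a(a-1)\cdots(a-n+1)$ for $n\ge1$; $\Omega_R=\{t\in R:(t)_{\underline{n}}\in R^\times\text{ for every }n\ge1\}$. For $t\in\Omega_R$: $(f\boxplus^H_tg)(n)=\sum_{i+j=n}\frac{(t)_{\underline{n}}}{(t)_{\underline{i}}(t)_{\underline{j}}}f(i)g(j)$, $n\in\mathbb{N}$. For $d\in\mathbb{Z}_{\ge1}$ let $h_{\le d}R=\{f\in HR:f(n)=0\text{ for }n>d\}$, and for $f,g\in h_{\le d}R$ let $(f\boxplus^H_dg)(n)=\sum_{i+j=n}\frac{(d)_{\underline{n}}}{(d)_{\underline{i}}(d)_{\underline{j}}}f(i)g(j)$ for $0\le n\le d$ and $(f\boxplus^H_dg)(n)=0$ for $n>d$. $\mathcal{U}(HR)=\{f\in HR:f(0)=1\}$ and $\mathcal{U}_d(HR)=\mathcal{U}(HR)\cap h_{\le d}R$. $\mathscr{G}f(z)=\sum_{n\ge0}f(n)z^n\in R[[z]]$. Logarithms are formal logarithms of power series with constant term $1$. Power-sum coordinates $p_n^H(f)$ of $f\in\mathcal{U}(HR)$: $\sum_{n\ge1}p_n^H(f)z^n=-z\frac{d}{dz}\log(\mathscr{G}f(z))$. For $r\in R$, the dilation is $(D_rf)(n)=r^nf(n)$. For $t\in\Omega_R$: $(\mathcal{E}_tf)(0)=1$, $(\mathcal{E}_tf)(n)=\frac{t^n}{(t)_{\underline{n}}}f(n)$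 for $n\ge1$, and the cumulants $\kappa_n^t(f)$ of $f\in\mathcal{U}(HR)$ are defined by $$\sum_{n\ge1}\kappa_n^t(f)z^n=-\frac{z}{t}\frac{d}{dz}\log\bigl(\mathscr{G}(\mathcal{E}_tf)(z)\bigr).$$ For $f\in\mathcal{U}_d(HR)$, $\kappa_n^d(f)$ is the coefficient of $z^n$ in $-\frac{z}{d}\frac{d}{dz}\log\left(1+\sum_{n=1}^{d}\frac{d^n}{(d)_{\underline{n}}}f(n)z^n\right)$. *)

theory Defs
  imports
    "HOL-Computational_Algebra.Formal_Power_Series"
    "HOL-Library.Poly_Mapping"
begin

class comm_rat_algebra_1 = comm_ring_1 +
  fixes scaleQ :: "rat \<Rightarrow> 'a \<Rightarrow> 'a"  (infixr \<open>*\<^sub>Q\<close> 75)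
  assumes scaleQ_add_right: "q *\<^sub>Q (x + y) = q *\<^sub>Q x + q *\<^sub>Q y"
    and scaleQ_add_left: "(p + q) *\<^sub>Q x = p *\<^sub>Q x + q *\<^sub>Q x"
    and scaleQ_scaleQ: "p *\<^sub>Q q *\<^sub>Q x = (p * q) *\<^sub>Q x"
    and scaleQ_one: "1 *\<^sub>Q x = x"
    and mult_scaleQ_left: "(q *\<^sub>Q x) * y = q *\<^sub>Q (x * y)"

text \<open>The inverse of a unit; the value at a non-unit is unspecified.\<close>

definition unit_inv :: "'a::comm_ring_1 \<Rightarrow> 'a" where
  "unit_inv u = (THE v. u * v = 1)"

definition falling :: "'a::comm_ring_1 \<Rightarrow> nat \<Rightarrow> 'a" where
  "falling a n = (\<Prod>i<n. a - of_nat i)"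

definition Omega :: "'a::comm_ring_1 set" where
  "Omega = {t. \<forall>n\<ge>1. falling t n dvd 1}"

text \<open>
  Elements of HR are functions from nat to the ring. The map from f to its ordinary generating
  series is \<^const>\<open>Abs_fps\<close>.
\<close>

definition UH :: "(nat \<Rightarrow> 'a::comm_ring_1) set" where
  "UH = {f. f 0 = 1}"

definition h_le :: "nat \<Rightarrow> (nat \<Rightarrow> 'a::comm_ring_1) set" where
  "h_le d = {f. \<forall>n>d. f n = 0}"

definition UH_le :: "nat \<Rightarrow> (nat \<Rightarrow> 'a::comm_ring_1) set" where
  "UH_le d = UH \<inter> h_le d"

definition boxplus ::
  "'a::comm_ring_1 \<Rightarrow> (nat \<Rightarrow> 'a) \<Rightarrow> (nat \<Rightarrow> 'a) \<Rightarrow> nat \<Rightarrow> 'a" where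
  "boxplus t f g n =
     (\<Sum>i\<le>n. falling t n * unit_inv (falling t i * falling t (n - i)) * f i * g (n - i))"

text \<open>
  For n at most d, every falling factorial of d that is inverted below is a positive integer, hence
  a unit in an algebra over the rationals.
\<close>

definition boxplus_le ::
  "nat \<Rightarrow> (nat \<Rightarrow> 'a::comm_ring_1) \<Rightarrow> (nat \<Rightarrow> 'a) \<Rightarrow> nat \<Rightarrow> 'a" where
  "boxplus_le d f g n = (if n \<le> d then boxplus (of_nat d) f g n else 0)"

definition dilation :: "'a::comm_ring_1 \<Rightarrow> (nat \<Rightarrow> 'a) \<Rightarrow> nat \<Rightarrow> 'a" where
  "dilation r f n = r ^ n * f n"

text \<open>
  The formal logarithm of a power series F with constant term 1: the series
  log (1 + u) composed with u = F - 1.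
\<close>

definition log_one_plus :: "'a::comm_rat_algebra_1 fps" where
  "log_one_plus = Abs_fps (\<lambda>k. if k = 0 then 0 else ((- 1) ^ (k + 1) / of_nat k) *\<^sub>Q 1)"

definition fps_log :: "'a::comm_rat_algebra_1 fps \<Rightarrow> 'a fps" where
  "fps_log F = fps_compose log_one_plus (F - 1)"

definition power_sum :: "(nat \<Rightarrow> 'a::comm_rat_algebra_1) \<Rightarrow> nat \<Rightarrow> 'a" where
  "power_sum f n = fps_nth (- (fps_X * fps_deriv (fps_log (Abs_fps f)))) n"

definition E_map :: "'a::comm_ring_1 \<Rightarrow> (nat \<Rightarrow> 'a) \<Rightarrow> nat \<Rightarrow> 'a" where
  "E_map t f n = (if n = 0 then 1 else t ^ n * unit_inv (falling t n) * f n)"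

definition cumulant ::
  "'a::comm_rat_algebra_1 \<Rightarrow> nat \<Rightarrow> (nat \<Rightarrow> 'a) \<Rightarrow> 'a" where
  "cumulant t n f =
     fps_nth (- (fps_const (unit_inv t) * fps_X * fps_deriv (fps_log (Abs_fps (E_map t f))))) n"

definition cumulant_le ::
  "nat \<Rightarrow> nat \<Rightarrow> (nat \<Rightarrow> 'a::comm_rat_algebra_1) \<Rightarrow> 'a" where
  "cumulant_le d n f =
     fps_nth (- (fps_const (unit_inv (of_nat d)) * fps_X * fps_deriv (fps_log
       (1 + (\<Sum>k=1..d. fps_const (of_nat d ^ k * unit_inv (falling (of_nat d) k) * f k)
                          * fps_X ^ k))))) n"

text \<open>
  Polynomials in variables indexed by nat, as finitely supported functions from exponent vectors to
  coefficients.
\<close>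

type_synonym 'a mpoly = "(nat \<Rightarrow>\<^sub>0 nat) \<Rightarrow>\<^sub>0 'a"

definition mpoly_eval :: "'a::comm_ring_1 mpoly \<Rightarrow> (nat \<Rightarrow> 'a) \<Rightarrow> 'a" where
  "mpoly_eval P x =
     (\<Sum>m\<in>Poly_Mapping.keys P. Poly_Mapping.lookup P m * (\<Prod>i\<in>Poly_Mapping.keys m. x i ^ Poly_Mapping.lookup m i))"

definition mpoly_vars :: "'a::comm_ring_1 mpoly \<Rightarrow> nat set" where
  "mpoly_vars P = (\<Union>m\<in>Poly_Mapping.keys P. Poly_Mapping.keys m)"

text \<open>The exponent vector of the monomial consisting of the single variable with index n.\<close>

definition var_monom :: "nat \<Rightarrow> (nat \<Rightarrow>\<^sub>0 nat)" where
  "var_monom n = Poly_Mapping.single n 1"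

end

theory Submission
  imports Defs
begin

text \<open>
  Power sums are characterised by Newton's identities, which turn a product of generating series
  into a sum of power sums and can be solved for the series by a polynomial recursion. Since
  \<open>E_map t\<close> carries the convolution to the product of series, the cumulants are additive; since the
  recursions are triangular, they are polynomials in the power sums with the stated leading term.
  For uniqueness, an additive \<open>\<phi>\<close> is an additive function \<open>\<Phi>\<close> of the vector of the first \<open>n\<close>
  cumulants, so it is the sum of its restrictions to the coordinate axes. On the \<open>i\<close>-th axis with
  \<open>i < n\<close>, dilation by 2 gives \<open>2 ^ i * \<Phi> y = 2 ^ n * \<Phi> y\<close>, so \<open>\<Phi>\<close> vanishes there. On the
  \<open>n\<close>-th axis all lower power sums vanish, and \<open>\<Phi>\<close> is an additive polynomial in a single
  variable, hence linear with the prescribed coefficient.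
\<close>

section \<open>Newton's identities\<close>

lemma scaleQ_zero_left: "0 *\<^sub>Q (x :: 'a::comm_rat_algebra_1) = 0"
  using scaleQ_add_left[of 0 0 x] by simp

lemma scaleQ_of_nat: "of_nat m *\<^sub>Q (x :: 'a::comm_rat_algebra_1) = of_nat m * x"
  by (induction m) (simp_all add: scaleQ_zero_left scaleQ_add_left scaleQ_one algebra_simps)

lemma of_nat_mult_scaleQ:
  "of_nat m * (q *\<^sub>Q (x :: 'a::comm_rat_algebra_1)) = (of_nat m * q) *\<^sub>Q x"
  by (metis scaleQ_of_nat scaleQ_scaleQ)

text \<open>Scaling by the rational \<open>1 / m\<close> undoes multiplication by \<open>m\<close>.
  This stands in for cancellation in an integral domain, as the ring may have zero divisors.\<close>

lemma of_nat_mult_cancel: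
  fixes x y :: "'a::comm_rat_algebra_1"
  assumes "m \<noteq> 0" and "of_nat m * x = of_nat m * y"
  shows "x = y"
proof -
  have "x = (1 / of_nat m) *\<^sub>Q (of_nat m *\<^sub>Q x)"
    using assms(1) by (simp add: scaleQ_scaleQ scaleQ_one)
  also have "\<dots> = (1 / of_nat m) *\<^sub>Q (of_nat m *\<^sub>Q y)"
    using assms(2) by (simp add: scaleQ_of_nat)
  also have "\<dots> = y"
    using assms(1) by (simp add: scaleQ_scaleQ scaleQ_one)
  finally show ?thesis .
qed

lemma of_nat_mult_inverse_scaleQ:
  assumes "m \<noteq> 0"
  shows "of_nat m * ((1 / of_nat m) *\<^sub>Q (x :: 'a::comm_rat_algebra_1)) = x"
  using assms by (simp add: of_nat_mult_scaleQ scaleQ_one)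

lemma of_nat_dvd_one:
  assumes "m \<noteq> 0"
  shows "(of_nat m :: 'a::comm_rat_algebra_1) dvd 1"
  by (metis assms dvd_triv_left of_nat_mult_inverse_scaleQ)

lemma scaleQ_minus_left: "(- q) *\<^sub>Q (x :: 'a::comm_rat_algebra_1) = - (q *\<^sub>Q x)"
  using scaleQ_add_left[of q "- q" x]
  by (simp add: scaleQ_zero_left eq_neg_iff_add_eq_0 add.commute)

text \<open>An analogue of \<open>fps_compose_deriv\<close>, which the library only has over integral domains.\<close>

lemma fps_log_deriv:
  fixes F :: "'a::comm_rat_algebra_1 fps"
  assumes "fps_nth F 0 = 1"
  shows "F * fps_deriv (fps_log F) = fps_deriv F"
proof (rule fps_ext)
  fix n
  define u where "u = F - 1"
  have u0: "fps_nth u 0 = 0" using assms by (simp add: u_def)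
  define L where "L = fps_nth (log_one_plus :: 'a fps)"
  have L: "of_nat (Suc i) * L (Suc i) = (- 1) ^ i" for i
  proof -
    have "of_nat (Suc i) * L (Suc i) = ((- 1) ^ i) *\<^sub>Q (1 :: 'a)"
      by (simp add: L_def log_one_plus_def of_nat_mult_scaleQ del: of_nat_Suc)
    also have "\<dots> = (- 1) ^ i"
      by (induction i) (simp_all add: scaleQ_one scaleQ_minus_left)
    finally show ?thesis .
  qed
  have L': "fps_const (of_nat (Suc i) * L (Suc i)) = (- 1) ^ i" for i
    unfolding L by (simp flip: fps_const_power fps_const_neg)
  \<comment> \<open>Coefficient \<open>n\<close> of a derivative reads coefficient
    \<open>n + 1\<close>, so the logarithm may be cut off there.\<close>
  define N :: nat where "N = n + 1"
  define S where "S = (\<Sum>i\<le>N. fps_const (L i) * u ^ i)"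
  have S: "fps_nth (fps_log F) k = fps_nth S k" if "k \<le> N" for k
  proof -
    have "fps_nth (fps_log F) k = (\<Sum>i=0..k. L i * fps_nth (u ^ i) k)"
      by (simp add: fps_log_def fps_compose_nth L_def u_def)
    also have "\<dots> = (\<Sum>i\<le>N. L i * fps_nth (u ^ i) k)"
      using that u0 by (intro sum.mono_neutral_left) (auto simp: startsby_zero_power_prefix not_le)
    finally show ?thesis by (simp add: S_def fps_sum_nth)
  qed
  have "fps_deriv S = (\<Sum>i\<le>N. fps_const (of_nat i * L i) * fps_deriv u * u ^ (i - 1))"
    unfolding S_def fps_deriv_sum
    by (intro sum.cong) (simp_all add: fps_deriv_power fps_const_mult[symmetric] mult_ac del: fps_const_mult)
  \<comment> \<open>The truncated geometric series in \<open>- u\<close> appears, an approximate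
    inverse of \<open>F = 1 - (- u)\<close>; the term \<open>i = 0\<close> vanishes because of its
    factor \<open>of_nat i\<close>.\<close>
  also have "\<dots> = (\<Sum>i\<le>n. (- u) ^ i) * fps_deriv u"
    unfolding N_def Suc_eq_plus1[symmetric] sum.atMost_Suc_shift
    by (simp only: L') (simp add: sum_distrib_left sum_distrib_right mult_ac power_minus[of u])
  finally have dS: "fps_deriv S = (\<Sum>i\<le>n. (- u) ^ i) * fps_deriv u" .
  have "F * fps_deriv S = ((1 - (- u)) * (\<Sum>i\<le>n. (- u) ^ i)) * fps_deriv u"
    unfolding dS by (simp add: u_def mult_ac)
  also have "\<dots> = (1 - (- u) ^ Suc n) * fps_deriv u"
    by (simp only: sum_gp_basic)
  finally have FS: "F * fps_deriv S = fps_deriv u - (- u) ^ Suc n * fps_deriv u"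
    by (simp add: algebra_simps)
  have "fps_nth (F * fps_deriv (fps_log F)) n = fps_nth (F * fps_deriv S) n"
    unfolding fps_mult_nth by (intro sum.cong) (auto simp: S N_def)
  also have "\<dots> = fps_nth (fps_deriv u) n"
  proof -
    \<comment> \<open>The remainder starts in degree \<open>n + 1\<close> at the earliest, because
      \<open>u\<close> has no constant term.\<close>
    have "fps_nth ((- u) ^ Suc n * fps_deriv u) n = 0"
      unfolding fps_mult_nth
      by (intro sum.neutral) (use u0 in \<open>auto simp: startsby_zero_power_prefix simp del: power_Suc\<close>)
    then show ?thesis unfolding FS by simp
  qed
  also have "\<dots> = fps_nth (fps_deriv F) n" by (simp add: u_def)
  finally show "fps_nth (F * fps_deriv (fps_log F)) n = fps_nth (fps_deriv F) n" .
qed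

lemma power_sum_0 [simp]: "power_sum f 0 = 0"
  by (simp add: power_sum_def)

text \<open>Multiplying the logarithmic derivative by the series clears its denominator; comparing
  coefficients then gives Newton's identities.\<close>

lemma Abs_fps_power_sum_mult:
  assumes "f 0 = 1"
  shows "Abs_fps (power_sum f) * Abs_fps f = - (fps_X * fps_deriv (Abs_fps f))"
proof -
  let ?F = "Abs_fps f"
  have "Abs_fps (power_sum f) = - (fps_X * fps_deriv (fps_log ?F))"
    by (simp add: fps_eq_iff power_sum_def)
  then have "Abs_fps (power_sum f) * ?F = - (fps_X * (?F * fps_deriv (fps_log ?F)))"
    by (simp add: mult_ac)
  then show ?thesis
    using assms by (simp add: fps_log_deriv)
qed

lemma fps_X_deriv_nth:
  "fps_nth (fps_X * fps_deriv (F :: 'a::comm_ring_1 fps)) n = of_nat n * fps_nth F n"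
  by (cases n) simp_all

lemma newton:
  assumes "f 0 = 1"
  shows "(\<Sum>k\<le>n. power_sum f k * f (n - k)) = - of_nat n * f n"
  using arg_cong[OF Abs_fps_power_sum_mult[of f, OF assms], of "\<lambda>F. fps_nth F n"]
  by (simp add: fps_mult_nth[of "Abs_fps _" "Abs_fps _"] fps_X_deriv_nth atMost_atLeast0)

lemma newton_split:
  assumes "f 0 = 1"
  shows "power_sum f n = - of_nat n * f n - (\<Sum>k<n. power_sum f k * f (n - k))"
  using newton[of f n] assms
  by (simp add: lessThan_Suc_atMost[symmetric] algebra_simps)

text \<open>As \<open>f 0 = 1\<close>, the identity in degree \<open>m\<close> determines
  \<open>q m\<close> from the earlier values. Power sums can hence be computed by guessing them and
  checking these identities in degrees up to \<open>n\<close>.\<close>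

lemma power_sum_unique:
  assumes "f 0 = 1" and "\<And>m. m \<le> n \<Longrightarrow> (\<Sum>k\<le>m. q k * f (m - k)) = - of_nat m * f m"
  shows "m \<le> n \<Longrightarrow> power_sum f m = q m"
proof (induction m rule: less_induct)
  case (less m)
  have "power_sum f m = - of_nat m * f m - (\<Sum>k<m. q k * f (m - k))"
    unfolding newton_split[of f m, OF assms(1)] using less by (auto intro!: sum.cong)
  also have "\<dots> = q m"
    using assms(2)[OF less.prems] assms(1)
    by (simp add: lessThan_Suc_atMost[symmetric] algebra_simps)
  finally show ?case .
qed

lemma power_sum_cong:
  assumes "f 0 = 1" and "\<And>k. k \<le> n \<Longrightarrow> f k = g k"
  shows "power_sum f n = power_sum g n"
proof (rule power_sum_unique[where n = n])
  have g: "g 0 = 1" using assms by force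
  show "(\<Sum>k\<le>m. power_sum g k * f (m - k)) = - of_nat m * f m" if "m \<le> n" for m
    using newton[of g m, OF g] that assms(2) by (simp cong: sum.cong)
qed (use assms in auto)

text \<open>The zeroth power sum vanishes, so Newton's sum in degree \<open>m\<close> involves only
  lower values of the sequence. It equals \<open>- m\<close> times the value at \<open>m\<close>,
  and \<open>m\<close> can be cancelled.\<close>

lemma eq_if_power_sum_eq:
  assumes "f 0 = 1" and "g 0 = 1" and "\<And>k. k \<le> n \<Longrightarrow> power_sum f k = power_sum g k"
  shows "m \<le> n \<Longrightarrow> f m = g m"
proof (induction m rule: less_induct)
  case (less m)
  show ?case
  proof (cases "m = 0")
    case False
    have "(\<Sum>k\<le>m. power_sum f k * f (m - k)) = (\<Sum>k\<le>m. power_sum g k * g (m - k))"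
    proof (rule sum.cong)
      fix k assume "k \<in> {..m}"
      then show "power_sum f k * f (m - k) = power_sum g k * g (m - k)"
        using less assms(3)[of k] by (cases "k = 0") auto
    qed simp
    then have "of_nat m * f m = of_nat m * g m"
      using assms(1,2) by (simp add: newton)
    then show ?thesis using False of_nat_mult_cancel by blast
  qed (use assms in auto)
qed

lemma power_sum_dilation:
  assumes "f 0 = 1"
  shows "power_sum (dilation r f) n = r ^ n * power_sum f n"
proof (rule power_sum_unique[where n = n])
  fix m
  have "(\<Sum>k\<le>m. r ^ k * power_sum f k * dilation r f (m - k))
      = r ^ m * (\<Sum>k\<le>m. power_sum f k * f (m - k))"
    unfolding dilation_def sum_distrib_left
    by (intro sum.cong) (auto simp: power_add[symmetric] mult_ac)
  then show "(\<Sum>k\<le>m. r ^ k * power_sum f k * dilation r f (m - k)) = - of_nat m * dilation r f m"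
    using newton[of f m] assms by (simp add: dilation_def mult_ac)
qed (use assms in \<open>auto simp: dilation_def\<close>)

text \<open>By the Leibniz rule the sum of the two power-sum series satisfies Newton's identities
  for the product. Agreement of \<open>h\<close> with the product up to degree \<open>n\<close> is
  enough, which covers truncated convolutions.\<close>

lemma power_sum_convolution:
  assumes "f 0 = 1" and "g 0 = 1" and "\<And>m. m \<le> n \<Longrightarrow> h m = (\<Sum>i\<le>m. f i * g (m - i))"
  shows "power_sum h n = power_sum f n + power_sum g n"
proof (rule power_sum_unique[where n = n])
  fix m assume m: "m \<le> n"
  let ?F = "Abs_fps f" and ?P = "Abs_fps (power_sum f)"
  let ?G = "Abs_fps g" and ?Q = "Abs_fps (power_sum g)"
  have "(?P + ?Q) * (?F * ?G) = (?P * ?F) * ?G + ?F * (?Q * ?G)"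
    by (simp add: algebra_simps)
  also have "\<dots> = - (fps_X * fps_deriv (?F * ?G))"
    using assms(1,2) by (simp only: Abs_fps_power_sum_mult) (simp add: algebra_simps)
  finally have "fps_nth ((?P + ?Q) * (?F * ?G)) m = fps_nth (- (fps_X * fps_deriv (?F * ?G))) m"
    by simp
  also have "\<dots> = - of_nat m * h m"
    using assms(3)[OF m]
    by (simp only: fps_neg_nth fps_X_deriv_nth) (simp add: fps_mult_nth atMost_atLeast0)
  also have "fps_nth ((?P + ?Q) * (?F * ?G)) m = (\<Sum>k\<le>m. (power_sum f k + power_sum g k) * h (m - k))"
    unfolding fps_mult_nth[of "?P + ?Q"] atMost_atLeast0
    using assms(3) m by (intro sum.cong) (auto simp: fps_mult_nth atMost_atLeast0)
  finally show "(\<Sum>k\<le>m. (power_sum f k + power_sum g k) * h (m - k)) = - of_nat m * h m" .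
qed (use assms(1,2) assms(3)[of 0] in auto)

text \<open>Newton's identities solved for the coefficients, dividing by the degree. The explicit
  recursion shows each value to be a polynomial in the prescribed power sums.\<close>

fun of_power_sums :: "(nat \<Rightarrow> 'a::comm_rat_algebra_1) \<Rightarrow> nat \<Rightarrow> 'a" where
  "of_power_sums q 0 = 1"
| "of_power_sums q (Suc n) =
    - ((1 / of_nat (Suc n)) *\<^sub>Q (\<Sum>k\<le>n. q (Suc k) * of_power_sums q (n - k)))"

lemma power_sum_of_power_sums:
  assumes "q 0 = 0"
  shows "power_sum (of_power_sums q) n = q n"
proof (rule power_sum_unique[where n = n])
  fix m
  show "(\<Sum>k\<le>m. q k * of_power_sums q (m - k)) = - of_nat m * of_power_sums q m"
  proof (cases m)
    case (Suc l)
    have "- of_nat (Suc l) * of_power_sums q (Suc l) = (\<Sum>k\<le>l. q (Suc k) * of_power_sums q (l - k))"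
      by (simp add: of_nat_mult_inverse_scaleQ del: of_nat_Suc)
    then show ?thesis
      unfolding Suc sum.atMost_Suc_shift using assms by simp
  qed (use assms in auto)
qed auto

section \<open>Polynomial functions\<close>

definition monom_eval :: "(nat \<Rightarrow>\<^sub>0 nat) \<Rightarrow> (nat \<Rightarrow> 'a::comm_ring_1) \<Rightarrow> 'a" where
  "monom_eval m x = (\<Prod>i\<in>Poly_Mapping.keys m. x i ^ Poly_Mapping.lookup m i)"

lemma monom_eval_superset:
  assumes "finite K" "Poly_Mapping.keys m \<subseteq> K"
  shows "monom_eval m x = (\<Prod>i\<in>K. x i ^ Poly_Mapping.lookup m i)"
  unfolding monom_eval_def
  using assms by (intro prod.mono_neutral_left) (auto simp: in_keys_iff)

lemma monom_eval_add: "monom_eval (m + m') x = monom_eval m x * monom_eval m' x"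
proof -
  let ?K = "Poly_Mapping.keys m \<union> Poly_Mapping.keys m'"
  have "monom_eval (m + m') x = (\<Prod>i\<in>?K. x i ^ Poly_Mapping.lookup (m + m') i)"
    using keys_add[of m m'] by (intro monom_eval_superset) auto
  also have "\<dots> = (\<Prod>i\<in>?K. x i ^ Poly_Mapping.lookup m i) * (\<Prod>i\<in>?K. x i ^ Poly_Mapping.lookup m' i)"
    by (simp add: lookup_add power_add prod.distrib)
  also have "\<dots> = monom_eval m x * monom_eval m' x"
    by (simp add: monom_eval_superset[of ?K])
  finally show ?thesis .
qed

lemma mpoly_eval_superset:
  assumes "finite K" "Poly_Mapping.keys P \<subseteq> K"
  shows "mpoly_eval P x = (\<Sum>m\<in>K. Poly_Mapping.lookup P m * monom_eval m x)"
  unfolding mpoly_eval_def monom_eval_def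
  using assms by (intro sum.mono_neutral_left) (auto simp: in_keys_iff)

lemma mpoly_eval_add: "mpoly_eval (P + Q) x = mpoly_eval P x + mpoly_eval Q x"
proof -
  let ?K = "Poly_Mapping.keys P \<union> Poly_Mapping.keys Q"
  have "mpoly_eval (P + Q) x = (\<Sum>m\<in>?K. Poly_Mapping.lookup (P + Q) m * monom_eval m x)"
    using keys_add[of P Q] by (intro mpoly_eval_superset) auto
  also have "\<dots> = mpoly_eval P x + mpoly_eval Q x"
    by (simp add: mpoly_eval_superset[of ?K] lookup_add distrib_right sum.distrib)
  finally show ?thesis .
qed

lemma mpoly_vars_add: "mpoly_vars (P + Q) \<subseteq> mpoly_vars P \<union> mpoly_vars Q"
  unfolding mpoly_vars_def using keys_add[of P Q] by blast

lemma mpoly_eval_single: "mpoly_eval (Poly_Mapping.single m c) x = c * monom_eval m x"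
  by (simp add: mpoly_eval_superset[of "{m}"])

lemma mpoly_eval_cong:
  assumes "\<And>i. i \<in> mpoly_vars P \<Longrightarrow> x i = y i"
  shows "mpoly_eval P x = mpoly_eval P y"
  unfolding mpoly_eval_def
proof (intro sum.cong arg_cong2[where f = times] prod.cong refl)
  fix m i assume "m \<in> Poly_Mapping.keys P" "i \<in> Poly_Mapping.keys m"
  then have "x i = y i" by (intro assms) (auto simp: mpoly_vars_def)
  then show "x i ^ Poly_Mapping.lookup m i = y i ^ Poly_Mapping.lookup m i" by simp
qed

text \<open>Every monomial other than a pure power of the \<open>n\<close>-th variable contains a
  variable that is set to 0. The bound \<open>N\<close> puts all pure powers occurring in
  \<open>P\<close> into the sum.\<close>

lemma mpoly_eval_axis:
  assumes "\<And>m. m \<in> Poly_Mapping.keys P \<Longrightarrow> Poly_Mapping.lookup m n \<le> N"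
  shows "mpoly_eval P (\<lambda>k. if k = n then z else 0) =
    (\<Sum>k\<le>N. Poly_Mapping.lookup P (Poly_Mapping.single n k) * z ^ k)"
proof -
  let ?x = "\<lambda>k. if k = n then z else 0"
  let ?I = "Poly_Mapping.single n ` {..N}"
  let ?K = "Poly_Mapping.keys P \<union> ?I"
  have inj: "inj_on (Poly_Mapping.single n) {..N}"
    by (metis inj_onI lookup_single_eq)
  have axis: "monom_eval (Poly_Mapping.single n k) ?x = z ^ k" for k
    by (simp add: monom_eval_superset[of "{n}"])
  have "monom_eval m ?x = 0" if m: "m \<in> Poly_Mapping.keys P" "m \<notin> ?I" for m
  proof -
    have "m \<noteq> Poly_Mapping.single n (Poly_Mapping.lookup m n)"
      using m assms by blast
    then obtain i where "Poly_Mapping.lookup m i \<noteq>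
        Poly_Mapping.lookup (Poly_Mapping.single n (Poly_Mapping.lookup m n)) i"
      by (metis poly_mapping_eqI)
    then have "i \<noteq> n" "i \<in> Poly_Mapping.keys m"
      by (auto simp: lookup_single in_keys_iff when_def split: if_splits)
    then show ?thesis
      unfolding monom_eval_def by (intro prod_zero bexI[of _ i]) (auto simp: in_keys_iff zero_power)
  qed
  then have "mpoly_eval P ?x = (\<Sum>m\<in>?I. Poly_Mapping.lookup P m * monom_eval m ?x)"
    unfolding mpoly_eval_superset[of ?K P ?x, simplified]
    by (intro sum.mono_neutral_right) auto
  then show ?thesis
    by (simp add: sum.reindex[OF inj] axis)
qed

text \<open>Only the set of variables is tracked and the polynomial stays hidden, so that
  polynomiality can be derived from closure under the ring operations.\<close>

definition poly_fun :: "nat set \<Rightarrow> ((nat \<Rightarrow> 'a::comm_ring_1) \<Rightarrow> 'a) \<Rightarrow> bool" where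
  "poly_fun A \<phi> \<longleftrightarrow> (\<exists>P. mpoly_vars P \<subseteq> A \<and> \<phi> = mpoly_eval P)"

lemma poly_fun_mono: "poly_fun A \<phi> \<Longrightarrow> A \<subseteq> B \<Longrightarrow> poly_fun B \<phi>"
  unfolding poly_fun_def by blast

lemma poly_fun_monom:
  assumes "Poly_Mapping.keys m \<subseteq> A"
  shows "poly_fun A (\<lambda>x. c * monom_eval m x)"
  unfolding poly_fun_def
  using assms by (intro exI[of _ "Poly_Mapping.single m c"])
      (auto simp: fun_eq_iff mpoly_eval_single mpoly_vars_def simp del: single_zero split: if_splits)

lemma poly_fun_const: "poly_fun A (\<lambda>x. c)"
  using poly_fun_monom[of 0 A c] by (simp add: monom_eval_def)

lemma poly_fun_var: "i \<in> A \<Longrightarrow> poly_fun A (\<lambda>x. x i)"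
  using poly_fun_monom[of "Poly_Mapping.single i 1" A 1] by (simp add: monom_eval_def)

lemma poly_fun_add:
  assumes "poly_fun A \<phi>" "poly_fun A \<psi>"
  shows "poly_fun A (\<lambda>x. \<phi> x + \<psi> x)"
proof -
  obtain P Q where "mpoly_vars P \<subseteq> A" "\<phi> = mpoly_eval P" "mpoly_vars Q \<subseteq> A" "\<psi> = mpoly_eval Q"
    using assms unfolding poly_fun_def by blast
  then show ?thesis
    unfolding poly_fun_def using mpoly_vars_add[of P Q]
    by (intro exI[of _ "P + Q"]) (auto simp: mpoly_eval_add)
qed

lemma poly_fun_sum: "(\<And>i. i \<in> I \<Longrightarrow> poly_fun A (\<phi> i)) \<Longrightarrow> poly_fun A (\<lambda>x. \<Sum>i\<in>I. \<phi> i x)"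
  by (induction I rule: infinite_finite_induct) (auto intro: poly_fun_const poly_fun_add)

lemma poly_fun_mult:
  assumes "poly_fun A \<phi>" "poly_fun A \<psi>"
  shows "poly_fun A (\<lambda>x. \<phi> x * \<psi> x)"
proof -
  obtain P Q where P: "mpoly_vars P \<subseteq> A" "\<phi> = mpoly_eval P" and Q: "mpoly_vars Q \<subseteq> A" "\<psi> = mpoly_eval Q"
    using assms unfolding poly_fun_def by blast
  have "\<phi> x * \<psi> x = (\<Sum>m\<in>Poly_Mapping.keys P. \<Sum>m'\<in>Poly_Mapping.keys Q.
      (Poly_Mapping.lookup P m * Poly_Mapping.lookup Q m') * monom_eval (m + m') x)" for x
    unfolding P(2) Q(2) mpoly_eval_def monom_eval_def[symmetric] sum_product monom_eval_add
    by (simp add: mult_ac)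
  moreover have "Poly_Mapping.keys (m + m') \<subseteq> A"
    if "m \<in> Poly_Mapping.keys P" "m' \<in> Poly_Mapping.keys Q" for m m'
    using that P(1) Q(1) keys_add[of m m'] unfolding mpoly_vars_def by blast
  ultimately show ?thesis
    by (simp add: poly_fun_sum poly_fun_monom)
qed

lemma poly_fun_diff:
  assumes "poly_fun A \<phi>" "poly_fun A \<psi>"
  shows "poly_fun A (\<lambda>x. \<phi> x - \<psi> x)"
  using poly_fun_add[OF assms(1) poly_fun_mult[OF poly_fun_const[of A "- 1"] assms(2)]] by simp

text \<open>Turns a rational scalar into a constant of the ring, so that closure of polynomial
  functions under products covers scaling.\<close>

lemma scaleQ_conv_mult: "q *\<^sub>Q (x :: 'a::comm_rat_algebra_1) = (q *\<^sub>Q 1) * x"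
  by (simp add: mult_scaleQ_left)

lemma poly_fun_of_power_sums: "poly_fun {1..n} (\<lambda>x :: nat \<Rightarrow> 'a::comm_rat_algebra_1. of_power_sums x n)"
proof (induction n rule: less_induct)
  case (less n)
  show ?case
  proof (cases n)
    case (Suc l)
    have "poly_fun {1..n} (\<lambda>x :: nat \<Rightarrow> 'a. x (Suc k) * of_power_sums x (l - k))" if "k \<le> l" for k
    proof (rule poly_fun_mult[OF poly_fun_var poly_fun_mono])
      show "poly_fun {1..l - k} (\<lambda>x :: nat \<Rightarrow> 'a. of_power_sums x (l - k))"
        using Suc by (intro less.IH) simp
    qed (use that Suc in auto)
    then have "poly_fun {1..n} (\<lambda>x :: nat \<Rightarrow> 'a. (- ((1 / of_nat (Suc l)) *\<^sub>Q 1)) *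
        (\<Sum>k\<le>l. x (Suc k) * of_power_sums x (l - k)))"
      by (intro poly_fun_mult[OF poly_fun_const] poly_fun_sum) auto
    also have "(\<lambda>x :: nat \<Rightarrow> 'a. (- ((1 / of_nat (Suc l)) *\<^sub>Q 1)) *
        (\<Sum>k\<le>l. x (Suc k) * of_power_sums x (l - k)))
      = (\<lambda>x :: nat \<Rightarrow> 'a. of_power_sums x n)"
      unfolding Suc of_power_sums.simps by (subst (2) scaleQ_conv_mult) (simp only: minus_mult_left)
    finally show ?thesis .
  qed (simp add: poly_fun_const)
qed

text \<open>The variables play the part of power sums of a sequence, and \<open>p n\<close> is the
  \<open>n\<close>-th power sum after its \<open>k\<close>-th term is multiplied by
  \<open>a k\<close>. Newton's identities before and after the weighting both contain
  \<open>n\<close> times the top term; eliminating it leaves only variables below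
  \<open>n\<close>.\<close>

lemma poly_fun_power_sum_weighted:
  fixes a :: "nat \<Rightarrow> 'a::comm_rat_algebra_1"
  assumes "a 0 = 1"
  defines "p \<equiv> \<lambda>n x. power_sum (\<lambda>k. a k * of_power_sums x k) n"
  shows "n \<ge> 1 \<Longrightarrow> poly_fun {1..<n} (\<lambda>x. p n x - a n * x n)"
proof (induction n rule: less_induct)
  case (less n)
  \<comment> \<open>The induction hypothesis concerns \<open>p k\<close> without its linear term;
    that term uses only the variable \<open>k < n\<close> and is added back.\<close>
  have p: "poly_fun {1..<n} (p k)" if "k < n" for k
  proof (cases "k = 0")
    case False
    have "poly_fun {1..<k} (\<lambda>x. p k x - a k * x k)"
      using less.IH[of k] that False by simp
    then have "poly_fun {1..<n} (\<lambda>x. p k x - a k * x k)"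
      by (rule poly_fun_mono) (use that in auto)
    moreover have "poly_fun {1..<n} (\<lambda>x. a k * x k)"
      by (rule poly_fun_mult[OF poly_fun_const poly_fun_var]) (use that False in auto)
    ultimately have "poly_fun {1..<n} (\<lambda>x. (p k x - a k * x k) + a k * x k)"
      by (rule poly_fun_add)
    then show ?thesis by simp
  qed (simp add: p_def poly_fun_const)
  have q: "poly_fun {1..<n} (\<lambda>x :: nat \<Rightarrow> 'a. of_power_sums x k)" if "k < n" for k
    using that by (intro poly_fun_mono[OF poly_fun_of_power_sums[of k]]) auto
  obtain l where l: "n = Suc l" using less.prems by (cases n) auto
  have eq: "p n x - a n * x n = a n * (\<Sum>k<l. x (Suc k) * of_power_sums x (l - k)) -
      (\<Sum>k<l. p (Suc k) x * (a (l - k) * of_power_sums x (l - k)))" for x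
  proof -
    have "- of_nat n * of_power_sums x n = (\<Sum>k<l. x (Suc k) * of_power_sums x (l - k)) + x n"
      unfolding l by (simp add: of_nat_mult_inverse_scaleQ lessThan_Suc_atMost[symmetric] del: of_nat_Suc)
    then have *: "- of_nat n * (a n * of_power_sums x n)
        = a n * ((\<Sum>k<l. x (Suc k) * of_power_sums x (l - k)) + x n)"
      by (subst mult.left_commute) simp
    have "p n x = - of_nat n * (a n * of_power_sums x n) -
        (\<Sum>k<n. p k x * (a (n - k) * of_power_sums x (n - k)))"
      unfolding p_def by (subst newton_split) (simp_all add: assms(1))
    \<comment> \<open>The term \<open>k = 0\<close> drops out because the zeroth power sum is
      0.\<close>
    also have "(\<Sum>k<n. p k x * (a (n - k) * of_power_sums x (n - k)))
        = (\<Sum>k<l. p (Suc k) x * (a (l - k) * of_power_sums x (l - k)))"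
      unfolding l sum.lessThan_Suc_shift by (simp add: p_def)
    finally show ?thesis unfolding * by (simp add: algebra_simps)
  qed
  show ?case
    unfolding eq
    by (intro poly_fun_diff poly_fun_mult poly_fun_sum poly_fun_const p q poly_fun_var) (auto simp: l)
qed

text \<open>
  Subtracting the value at \<open>2 * j\<close> from \<open>2 ^ N\<close> times the value at \<open>j\<close> kills the top coefficient
  and multiplies the others by nonzero integers, which are units.
\<close>

lemma coeffs_zero_if_vanishes_on_nat:
  fixes b :: "nat \<Rightarrow> 'a::comm_rat_algebra_1"
  assumes "\<And>j :: nat. (\<Sum>k\<le>N. b k * of_nat j ^ k) = 0"
  shows "k \<le> N \<Longrightarrow> b k = 0"
  using assms
proof (induction N arbitrary: b k)
  case 0
  then show ?case using "0.prems"(2)[of 1] by simp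
next
  case (Suc N)
  \<comment> \<open>The factors are written as natural numbers so that they can be cancelled as
    nonzero integers; the subtraction is exact as \<open>2 ^ k <= 2 ^ Suc N\<close>.\<close>
  have pow: "of_nat (2 ^ Suc N - 2 ^ k) = (2 ^ Suc N - 2 ^ k :: 'a)" if "k \<le> N" for k
    using power_increasing[of k "Suc N" "2 :: nat"] that by (simp add: of_nat_diff del: power_Suc)
  have low: "b k = 0" if "k \<le> N" for k
  proof -
    have "(\<Sum>k\<le>N. (of_nat (2 ^ Suc N - 2 ^ k) * b k) * of_nat j ^ k) = 0" for j
    proof -
      have "(\<Sum>k\<le>N. (of_nat (2 ^ Suc N - 2 ^ k) * b k) * of_nat j ^ k)
          = (\<Sum>k\<le>Suc N. (2 ^ Suc N - 2 ^ k) * b k * of_nat j ^ k)"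
        by (simp add: pow del: power_Suc)
      also have "\<dots> = 2 ^ Suc N * (\<Sum>k\<le>Suc N. b k * of_nat j ^ k) - (\<Sum>k\<le>Suc N. b k * of_nat (2 * j) ^ k)"
        unfolding sum_distrib_left sum_subtractf[symmetric]
        by (intro sum.cong) (simp_all add: algebra_simps power_mult_distrib del: power_Suc)
      also have "\<dots> = 0" by (simp only: Suc.prems(2)) simp
      finally show ?thesis .
    qed
    then have "of_nat (2 ^ Suc N - 2 ^ k) * b k = of_nat (2 ^ Suc N - 2 ^ k) * 0"
      using Suc.IH[of k "\<lambda>k. of_nat (2 ^ Suc N - 2 ^ k) * b k"] that by simp
    then show ?thesis
      by (rule of_nat_mult_cancel[rotated])
        (use power_strict_increasing[of k "Suc N" "2 :: nat"] that in \<open>simp del: power_Suc\<close>)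
  qed
  have "b (Suc N) = 0"
    using Suc.prems(2)[of 1] low by simp
  then show ?case using low Suc.prems(1) by (cases "k = Suc N") auto
qed

section \<open>Cumulants\<close>

lemma unit_inv:
  assumes "u dvd (1 :: 'a::comm_ring_1)"
  shows "u * unit_inv u = 1"
proof -
  obtain v where v: "u * v = 1" using assms by (metis dvdE)
  have "\<exists>!v. u * v = 1"
  proof (rule ex1I[of _ v])
    fix w assume "u * w = 1"
    then show "w = v" using v by (metis mult.assoc mult.commute mult_1)
  qed (rule v)
  then show ?thesis unfolding unit_inv_def by (rule theI')
qed

lemma unit_inv_eqI:
  fixes u :: "'a::comm_ring_1"
  assumes "u * v = 1"
  shows "unit_inv u = v"
  by (metis assms unit_inv dvd_triv_left mult.assoc mult.commute mult_1)

lemma unit_inv_mult: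
  fixes u v :: "'a::comm_ring_1"
  assumes "u dvd 1" "v dvd 1"
  shows "unit_inv (u * v) = unit_inv u * unit_inv v"
proof (rule unit_inv_eqI)
  have "u * v * (unit_inv u * unit_inv v) = (u * unit_inv u) * (v * unit_inv v)"
    by (simp only: mult_ac)
  then show "u * v * (unit_inv u * unit_inv v) = 1" using assms by (simp add: unit_inv)
qed

lemma unit_mult_cancel:
  fixes u :: "'a::comm_ring_1"
  assumes "u dvd 1" "u * x = u * y"
  shows "x = y"
  by (metis assms unit_inv mult.assoc mult.commute mult_1)

lemma falling_0 [simp]: "falling t 0 = 1"
  by (simp add: falling_def)

lemma falling_1 [simp]: "falling t (Suc 0) = t"
  by (simp add: falling_def)

lemma unit_inv_1 [simp]: "unit_inv 1 = (1 :: 'a::comm_ring_1)"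
  by (rule unit_inv_eqI) simp

lemma unit_mult: "u dvd 1 \<Longrightarrow> v dvd 1 \<Longrightarrow> u * v dvd (1 :: 'a::comm_ring_1)"
  using mult_dvd_mono[of u 1 v 1] by simp

lemma unit_power: "u dvd 1 \<Longrightarrow> u ^ n dvd (1 :: 'a::comm_ring_1)"
  using dvd_power_same[of u 1 n] by simp

lemma unit_unit_inv: "u dvd 1 \<Longrightarrow> unit_inv u dvd (1 :: 'a::comm_ring_1)"
  by (metis unit_inv dvd_triv_right)

text \<open>For \<open>k <= d\<close> all factors \<open>d - i\<close> are positive integers, so the
  product is a nonzero integer and thus a unit.\<close>

lemma unit_falling_of_nat:
  assumes "k \<le> d"
  shows "falling (of_nat d) k dvd (1 :: 'a::comm_rat_algebra_1)"
proof -
  have "falling (of_nat d) k = (of_nat (\<Prod>i<k. d - i) :: 'a)"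
    unfolding falling_def of_nat_prod using assms by (intro prod.cong) (auto simp: of_nat_diff)
  moreover have "(\<Prod>i<k. d - i) \<noteq> 0" using assms by simp
  ultimately show ?thesis using of_nat_dvd_one by metis
qed

section \<open>The rescaling \<open>E_map\<close> and additivity of cumulants\<close>

lemma E_map_eq: "f 0 = 1 \<Longrightarrow> E_map t f k = t ^ k * unit_inv (falling t k) * f k"
  by (simp add: E_map_def)

lemma E_map_0 [simp]: "E_map t f 0 = 1"
  by (simp add: E_map_def)

lemma E_map_dilation: "E_map t (dilation r f) = dilation r (E_map t f)"
  by (auto simp: fun_eq_iff E_map_def dilation_def)

lemma cumulant_eq: "cumulant t n f = unit_inv t * power_sum (E_map t f) n"
  by (simp add: cumulant_def power_sum_def mult.assoc)

lemma cumulant_dilation: "cumulant t n (dilation r f) = r ^ n * cumulant t n f"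
  by (simp add: cumulant_eq E_map_dilation power_sum_dilation mult_ac)

lemma boxplus_0: "f 0 = 1 \<Longrightarrow> g 0 = 1 \<Longrightarrow> boxplus t f g 0 = 1"
  by (simp add: boxplus_def)

text \<open>The factor \<open>falling t m\<close> of the convolution cancels against the inverse in
  \<open>E_map\<close>, and the remaining weights split over \<open>i\<close> and
  \<open>m - i\<close>, leaving a Cauchy product. All assumptions stop at degree \<open>n\<close>,
  since for \<open>t = d\<close> higher falling factorials vanish.\<close>

lemma cumulant_boxplus:
  assumes "f 0 = 1" "g 0 = 1"
    and unit: "\<And>k. 1 \<le> k \<Longrightarrow> k \<le> n \<Longrightarrow> falling t k dvd 1"
    and h: "\<And>k. k \<le> n \<Longrightarrow> h k = boxplus t f g k"
  shows "cumulant t n h = cumulant t n f + cumulant t n g"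
proof -
  have unit': "falling t k dvd 1" if "k \<le> n" for k
    using unit[of k] that by (cases "k = 0") auto
  have h0: "h 0 = 1" using h[of 0] assms(1,2) by (simp add: boxplus_0)
  have "power_sum (E_map t h) n = power_sum (E_map t f) n + power_sum (E_map t g) n"
  proof (rule power_sum_convolution)
    fix m assume m: "m \<le> n"
    have "E_map t h m = (\<Sum>i\<le>m. (falling t m * unit_inv (falling t m)) *
        (t ^ m * unit_inv (falling t i * falling t (m - i)) * f i * g (m - i)))"
      unfolding E_map_eq[of h, OF h0] h[OF m] boxplus_def sum_distrib_left
      by (simp only: mult_ac)
    also have "\<dots> = (\<Sum>i\<le>m. E_map t f i * E_map t g (m - i))"
    proof (rule sum.cong[OF refl])
      fix i assume "i \<in> {..m}"
      then have i: "i \<le> n" "m - i \<le> n" "t ^ m = t ^ i * t ^ (m - i)"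
        using m by (auto simp flip: power_add)
      show "(falling t m * unit_inv (falling t m)) *
          (t ^ m * unit_inv (falling t i * falling t (m - i)) * f i * g (m - i))
        = E_map t f i * E_map t g (m - i)"
        unfolding unit_inv[OF unit'[OF m]] unit_inv_mult[OF unit'[OF i(1)] unit'[OF i(2)]] i(3)
          E_map_eq[of f, OF assms(1)] E_map_eq[of g, OF assms(2)]
        by (simp add: mult_ac)
    qed
    finally show "E_map t h m = (\<Sum>i\<le>m. E_map t f i * E_map t g (m - i))" .
  qed auto
  then show ?thesis by (simp add: cumulant_eq distrib_left)
qed

text \<open>Each further product in Newton's identity contains either the zeroth power sum or one of
  the vanishing lower coefficients.\<close>

lemma power_sum_one_zero_prefix:
  assumes "f 0 = 1" "\<And>k. 1 \<le> k \<Longrightarrow> k < n \<Longrightarrow> f k = 0"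
  shows "power_sum f n = - of_nat n * f n"
proof -
  have "power_sum f k * f (n - k) = 0" if "k < n" for k
    using assms(2)[of "n - k"] that by (cases "k = 0") auto
  then show ?thesis using newton_split[of f n] assms(1) by simp
qed

lemma power_sum_indicator: "power_sum (\<lambda>k. if k = 0 then 1 else 0) n = 0"
  by (subst power_sum_one_zero_prefix) auto

text \<open>
  Both halves of the theorem are instances: \<open>S\<close> is the set of all admissible \<open>f\<close> or its truncation
  at \<open>d\<close>, and only the values up to the degree \<open>n\<close> of the cumulant matter.
\<close>

locale free_convolution =
  fixes t :: "'a::comm_rat_algebra_1" and n :: nat and S :: "(nat \<Rightarrow> 'a) set"
    and conv :: "(nat \<Rightarrow> 'a) \<Rightarrow> (nat \<Rightarrow> 'a) \<Rightarrow> nat \<Rightarrow> 'a"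
  assumes n_ge_1: "1 \<le> n"
    and unit_falling: "1 \<le> k \<Longrightarrow> k \<le> n \<Longrightarrow> falling t k dvd 1"
    and S_0: "f \<in> S \<Longrightarrow> f 0 = 1"
    and conv_closed: "f \<in> S \<Longrightarrow> g \<in> S \<Longrightarrow> conv f g \<in> S"
    and conv_eq: "f \<in> S \<Longrightarrow> g \<in> S \<Longrightarrow> k \<le> n \<Longrightarrow> conv f g k = boxplus t f g k"
    and dilation_closed: "f \<in> S \<Longrightarrow> dilation r f \<in> S"
    and extension: "a 0 = 1 \<Longrightarrow> \<exists>f\<in>S. \<forall>k\<le>n. f k = a k"
begin

definition leading :: 'a where
  "leading = t ^ (n - 1) * unit_inv (falling t n)"

lemma unit_t: "t dvd 1"
  using unit_falling[of 1] n_ge_1 by simp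

lemma unit_falling': "k \<le> n \<Longrightarrow> falling t k dvd 1"
  using unit_falling[of k] by (cases "k = 0") auto

lemma unit_leading: "leading dvd 1"
  unfolding leading_def by (intro unit_mult unit_power unit_unit_inv unit_t unit_falling') simp

text \<open>This is the shape in which the coefficient arises: the prefactor of the cumulant times
  the weight of \<open>E_map\<close> in degree \<open>n\<close>.\<close>

lemma leading_eq: "leading = unit_inv t * (t ^ n * unit_inv (falling t n))"
proof -
  have "t ^ n = t * t ^ (n - 1)" using n_ge_1 by (simp flip: power_Suc)
  then have "unit_inv t * (t ^ n * unit_inv (falling t n)) = (t * unit_inv t) * leading"
    by (simp add: leading_def mult_ac)
  then show ?thesis by (simp add: unit_inv unit_t)
qed

lemma cumulant_conv:
  assumes "f \<in> S" "g \<in> S" "k \<le> n"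
  shows "cumulant t k (conv f g) = cumulant t k f + cumulant t k g"
  using assms by (intro cumulant_boxplus S_0 unit_falling conv_eq) auto

lemma cumulant_polynomial:
  "\<exists>P :: 'a mpoly. mpoly_vars P \<subseteq> {1..n}
      \<and> Poly_Mapping.lookup P (var_monom n) = leading
      \<and> (\<forall>m\<in>Poly_Mapping.keys P. m \<noteq> var_monom n \<longrightarrow> Poly_Mapping.keys m \<subseteq> {1..<n})
      \<and> (\<forall>f\<in>S. cumulant t n f = mpoly_eval P (power_sum f))"
proof -
  \<comment> \<open>With the weights of \<open>E_map t\<close>, the function \<open>p\<close>
    expresses the \<open>n\<close>-th power sum of \<open>E_map t f\<close> through the power sums
    of \<open>f\<close>.\<close>
  define a where "a k = t ^ k * unit_inv (falling t k)" for k
  define p where "p x = power_sum (\<lambda>k. a k * of_power_sums x k) n" for x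
  have "poly_fun {1..<n} (\<lambda>x. unit_inv t * (p x - a n * x n))"
    unfolding p_def using n_ge_1
    by (intro poly_fun_mult[OF poly_fun_const] poly_fun_power_sum_weighted) (auto simp: a_def)
  then obtain Q where Q: "mpoly_vars Q \<subseteq> {1..<n}"
      "\<And>x. unit_inv t * (p x - a n * x n) = mpoly_eval Q x"
    unfolding poly_fun_def fun_eq_iff by blast
  let ?m = "Poly_Mapping.single (var_monom n) leading"
  have keys_var: "Poly_Mapping.keys (var_monom n) = {n}"
    by (simp add: var_monom_def)
  have Qn: "Poly_Mapping.keys m \<subseteq> {1..<n}" if "m \<in> Poly_Mapping.keys Q" for m
    using Q(1) that by (auto simp: mpoly_vars_def)
  \<comment> \<open>\<open>Q\<close> avoids the variable \<open>n\<close>, so adding it leaves the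
    coefficient of the linear monomial unchanged.\<close>
  then have n_notin: "var_monom n \<notin> Poly_Mapping.keys Q"
    using keys_var by force
  have keys: "Poly_Mapping.keys (?m + Q) \<subseteq> insert (var_monom n) (Poly_Mapping.keys Q)"
    using keys_add[of ?m Q] by (auto split: if_splits)
  show ?thesis
  proof (intro exI[of _ "?m + Q"] conjI ballI impI)
    have "Poly_Mapping.keys m \<subseteq> {1..n}" if "m \<in> Poly_Mapping.keys (?m + Q)" for m
    proof (cases "m = var_monom n")
      case True
      then show ?thesis using keys_var n_ge_1 by simp
    next
      case False
      then have "Poly_Mapping.keys m \<subseteq> {1..<n}" using that keys Qn by blast
      then show ?thesis by auto
    qed
    then show "mpoly_vars (?m + Q) \<subseteq> {1..n}"
      unfolding mpoly_vars_def by blast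
    show "Poly_Mapping.lookup (?m + Q) (var_monom n) = leading"
      using n_notin by (simp add: lookup_add in_keys_iff)
    show "Poly_Mapping.keys m \<subseteq> {1..<n}"
      if "m \<in> Poly_Mapping.keys (?m + Q)" "m \<noteq> var_monom n" for m
      using that keys Qn by blast
    show "cumulant t n f = mpoly_eval (?m + Q) (power_sum f)" if f: "f \<in> S" for f
    proof -
      \<comment> \<open>Recovering \<open>f\<close> from its power sums makes the cumulant a
        function of the power sums alone.\<close>
      have "of_power_sums (power_sum f) k = f k" for k
        by (rule eq_if_power_sum_eq[where n = k]) (use f in \<open>auto simp: S_0 power_sum_of_power_sums\<close>)
      then have "E_map t f = (\<lambda>k. a k * of_power_sums (power_sum f) k)"
        using f by (simp add: fun_eq_iff S_0 E_map_eq a_def)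
      then have "cumulant t n f = unit_inv t * p (power_sum f)"
        by (simp add: cumulant_eq p_def)
      also have "\<dots> = leading * power_sum f n + mpoly_eval Q (power_sum f)"
        unfolding Q(2)[symmetric] leading_eq by (simp add: a_def algebra_simps)
      also have "\<dots> = mpoly_eval (?m + Q) (power_sum f)"
        by (simp add: mpoly_eval_add mpoly_eval_single var_monom_def monom_eval_def)
      finally show ?thesis .
    qed
  qed
qed

section \<open>Cumulants as coordinates\<close>

lemma exists_with_cumulants: "\<exists>f\<in>S. \<forall>k. 1 \<le> k \<longrightarrow> k \<le> n \<longrightarrow> cumulant t k f = y k"
proof -
  \<comment> \<open>Prescribed cumulants become power sums after multiplication by \<open>t\<close>;
    the value at 0 must be 0, as for every power-sum sequence.\<close>
  define F where "F = of_power_sums (\<lambda>k. if k = 0 then 0 else t * y k)"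
  have F0: "F 0 = 1" by (simp add: F_def)
  \<comment> \<open>Dividing out the weights of \<open>E_map\<close> gives a sequence starting with
    1, which \<open>extension\<close> realises in \<open>S\<close> up to degree
    \<open>n\<close>.\<close>
  obtain f where f: "f \<in> S" "\<And>k. k \<le> n \<Longrightarrow> f k = F k * falling t k * unit_inv (t ^ k)"
    using extension[of "\<lambda>k. F k * falling t k * unit_inv (t ^ k)"] F0 by auto
  have E: "E_map t f k = F k" if "k \<le> n" for k
  proof -
    have "E_map t f k = (t ^ k * unit_inv (t ^ k)) * (falling t k * unit_inv (falling t k)) * F k"
      using f that by (simp add: E_map_eq S_0 mult_ac)
    then show ?thesis using that by (simp add: unit_inv unit_power unit_t unit_falling')
  qed
  have "cumulant t k f = y k" if "1 \<le> k" "k \<le> n" for k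
  proof -
    have "power_sum (E_map t f) k = power_sum F k"
      using E that by (intro power_sum_cong) auto
    also have "\<dots> = t * y k"
      using that by (simp add: F_def power_sum_of_power_sums)
    finally show ?thesis
      using unit_inv[OF unit_t] by (simp add: cumulant_eq flip: mult.assoc) (simp add: mult_ac)
  qed
  then show ?thesis using f(1) by blast
qed

lemma power_sum_E_map: "power_sum (E_map t f) k = t * cumulant t k f"
  using unit_inv[OF unit_t] by (simp add: cumulant_eq flip: mult.assoc)

lemma E_map_cancel:
  assumes "f 0 = 1" "g 0 = 1" "k \<le> n" "E_map t f k = E_map t g k"
  shows "f k = g k"
proof (rule unit_mult_cancel)
  show "t ^ k * unit_inv (falling t k) dvd 1"
    using assms(3) by (intro unit_mult unit_power unit_unit_inv unit_t unit_falling')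
qed (use assms in \<open>simp add: E_map_eq\<close>)

text \<open>Up to the factor \<open>t\<close>, cumulants are the power sums of
  \<open>E_map t f\<close>. These determine \<open>E_map t f\<close>, whose weights are
  units.\<close>

lemma cumulants_determine:
  assumes "f \<in> S" "g \<in> S" "\<And>k. 1 \<le> k \<Longrightarrow> k \<le> n \<Longrightarrow> cumulant t k f = cumulant t k g" "k \<le> n"
  shows "f k = g k"
proof (rule E_map_cancel)
  have "power_sum (E_map t f) j = power_sum (E_map t g) j" if "j \<le> n" for j
    using assms(3)[of j] that by (cases "j = 0") (auto simp: power_sum_E_map)
  then show "E_map t f k = E_map t g k"
    by (rule eq_if_power_sum_eq[where n = n, rotated 2]) (use assms(4) in auto)
qed (use assms S_0 in auto)

text \<open>Vanishing lower cumulants force the lower coefficients of \<open>f\<close> to vanish.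
  The top power sum and the top cumulant are then both multiples of \<open>f n\<close>, with ratio
  \<open>leading\<close>.\<close>

lemma power_sum_if_lower_cumulants_0:
  assumes "f \<in> S" and low: "\<And>k. 1 \<le> k \<Longrightarrow> k < n \<Longrightarrow> cumulant t k f = 0"
  shows "1 \<le> k \<Longrightarrow> k < n \<Longrightarrow> power_sum f k = 0" and "leading * power_sum f n = cumulant t n f"
proof -
  have f0: "f 0 = 1" using assms(1) by (rule S_0)
  have f: "f k = 0" if "1 \<le> k" "k < n" for k
  proof -
    \<comment> \<open>Comparison with the series 1, all of whose power sums vanish.\<close>
    have "power_sum (E_map t f) j = power_sum (\<lambda>k. if k = 0 then 1 else 0) j" if "j \<le> k" for j
      using low[of j] that \<open>k < n\<close> unfolding power_sum_indicator
      by (cases "j = 0") (auto simp: power_sum_E_map)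
    then have "E_map t f k = (if k = 0 then 1 else 0)"
      by (rule eq_if_power_sum_eq[where g = "\<lambda>k. if k = 0 then 1 else 0" and n = k, rotated 2]) auto
    then have "E_map t f k = E_map t (\<lambda>k. if k = 0 then 1 else 0) k"
      using that by (simp add: E_map_def)
    then have "f k = (if k = 0 then 1 else 0)"
      by (rule E_map_cancel[rotated 3]) (use f0 that in auto)
    then show ?thesis using that by simp
  qed
  show "power_sum f k = 0" if "1 \<le> k" "k < n"
    using f f0 that by (subst power_sum_one_zero_prefix) auto
  have "power_sum f n = - of_nat n * f n"
    using f f0 by (intro power_sum_one_zero_prefix)
  moreover have "power_sum (E_map t f) n = - of_nat n * E_map t f n"
    using f n_ge_1 by (intro power_sum_one_zero_prefix) (auto simp: E_map_def)
  ultimately show "leading * power_sum f n = cumulant t n f"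
    using f0 by (simp add: cumulant_eq leading_eq E_map_eq mult_ac)
qed

end

section \<open>Uniqueness: additive functionals in cumulant coordinates\<close>

locale additive_functional = free_convolution +
  fixes \<phi> :: "(nat \<Rightarrow> 'a) \<Rightarrow> 'a" and P :: "'a mpoly"
  assumes vars_P: "mpoly_vars P \<subseteq> {1..n}"
    and lookup_P: "Poly_Mapping.lookup P (var_monom n) = leading"
    and phi_eval: "f \<in> S \<Longrightarrow> \<phi> f = mpoly_eval P (power_sum f)"
    and phi_dilation: "f \<in> S \<Longrightarrow> \<phi> (dilation r f) = r ^ n * \<phi> f"
    and phi_conv: "f \<in> S \<Longrightarrow> g \<in> S \<Longrightarrow> \<phi> (conv f g) = \<phi> f + \<phi> g"
begin

text \<open>The value of \<open>\<phi>\<close> depends only on the first \<open>n\<close> power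
  sums, hence on the coefficients up to \<open>n\<close>, which the cumulants determine.\<close>

lemma phi_cong:
  assumes "f \<in> S" "g \<in> S" "\<And>k. 1 \<le> k \<Longrightarrow> k \<le> n \<Longrightarrow> cumulant t k f = cumulant t k g"
  shows "\<phi> f = \<phi> g"
proof -
  have fg: "f k = g k" if "k \<le> n" for k
    using cumulants_determine[of f g k] assms that by blast
  have "mpoly_eval P (power_sum f) = mpoly_eval P (power_sum g)"
  proof (rule mpoly_eval_cong, rule power_sum_cong)
    fix k assume "k \<in> mpoly_vars P"
    then have "k \<le> n" using vars_P by auto
    then show "f j = g j" if "j \<le> k" for j using fg[of j] that by simp
  qed (rule S_0[OF assms(1)])
  then show ?thesis
    using assms(1,2) by (simp add: phi_eval)
qed

definition with_cumulants :: "(nat \<Rightarrow> 'a) \<Rightarrow> nat \<Rightarrow> 'a" where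
  "with_cumulants y = (SOME f. f \<in> S \<and> (\<forall>k. 1 \<le> k \<longrightarrow> k \<le> n \<longrightarrow> cumulant t k f = y k))"

lemma with_cumulants:
  "with_cumulants y \<in> S" "1 \<le> k \<Longrightarrow> k \<le> n \<Longrightarrow> cumulant t k (with_cumulants y) = y k"
  using someI_ex[of "\<lambda>f. f \<in> S \<and> (\<forall>k. 1 \<le> k \<longrightarrow> k \<le> n \<longrightarrow> cumulant t k f = y k)"]
    exists_with_cumulants[of y]
  unfolding with_cumulants_def by blast+

text \<open>In cumulant coordinates the convolution becomes pointwise addition. The choice made in
  \<open>with_cumulants\<close> is harmless by \<open>phi_cong\<close>.\<close>

definition \<Phi> :: "(nat \<Rightarrow> 'a) \<Rightarrow> 'a" where
  "\<Phi> y = \<phi> (with_cumulants y)"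

lemma Phi_eqI:
  assumes "f \<in> S" "\<And>k. 1 \<le> k \<Longrightarrow> k \<le> n \<Longrightarrow> cumulant t k f = y k"
  shows "\<Phi> y = \<phi> f"
  unfolding \<Phi>_def using assms by (intro phi_cong) (auto simp: with_cumulants)

lemma Phi_cong: "(\<And>k. 1 \<le> k \<Longrightarrow> k \<le> n \<Longrightarrow> y k = z k) \<Longrightarrow> \<Phi> y = \<Phi> z"
  using Phi_eqI[of "with_cumulants z" y] by (simp add: with_cumulants \<Phi>_def)

lemma Phi_add: "\<Phi> (\<lambda>k. y k + z k) = \<Phi> y + \<Phi> z"
proof -
  have "\<Phi> (\<lambda>k. y k + z k) = \<phi> (conv (with_cumulants y) (with_cumulants z))"
    by (intro Phi_eqI) (auto simp: conv_closed with_cumulants cumulant_conv)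
  then show ?thesis by (simp add: phi_conv with_cumulants \<Phi>_def)
qed

lemma Phi_dilation: "\<Phi> (\<lambda>k. r ^ k * y k) = r ^ n * \<Phi> y"
proof -
  have "\<Phi> (\<lambda>k. r ^ k * y k) = \<phi> (dilation r (with_cumulants y))"
    by (intro Phi_eqI) (auto simp: dilation_closed with_cumulants cumulant_dilation)
  then show ?thesis by (simp add: phi_dilation with_cumulants \<Phi>_def)
qed

lemma Phi_zero: "\<Phi> (\<lambda>k. 0) = 0"
  using Phi_add[of "\<lambda>k. 0" "\<lambda>k. 0"] by simp

lemma Phi_of_nat_mult: "\<Phi> (\<lambda>k. of_nat m * y k) = of_nat m * \<Phi> y"
  by (induction m) (simp_all add: Phi_zero Phi_add distrib_right)

abbreviation axis :: "nat \<Rightarrow> 'a \<Rightarrow> nat \<Rightarrow> 'a" where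
  "axis i z \<equiv> \<lambda>k. if k = i then z else 0"

lemma Phi_eq_sum: "\<Phi> y = (\<Sum>i\<in>{1..n}. \<Phi> (axis i (y i)))"
proof -
  have "\<Phi> (\<lambda>k. if k \<in> A then y k else 0) = (\<Sum>i\<in>A. \<Phi> (axis i (y i)))" if "finite A" for A
    using that
  proof (induction A rule: finite_induct)
    case empty
    then show ?case by (simp add: Phi_zero)
  next
    case (insert i A)
    have "\<Phi> (\<lambda>k. if k \<in> insert i A then y k else 0)
        = \<Phi> (\<lambda>k. axis i (y i) k + (if k \<in> A then y k else 0))"
      using insert.hyps by (intro Phi_cong) auto
    then show ?case using insert by (simp add: Phi_add)
  qed
  from this[of "{1..n}"] show ?thesis
    using Phi_cong[of y "\<lambda>k. if k \<in> {1..n} then y k else 0"] by simp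
qed

text \<open>Additivity gives weight \<open>2 ^ i\<close> under doubling where homogeneity gives \<open>2 ^ n\<close>.\<close>

lemma Phi_axis_lower:
  assumes "i < n"
  shows "\<Phi> (axis i z) = 0"
proof -
  \<comment> \<open>On the \<open>i\<close>-th axis the weights \<open>2 ^ k\<close> act as the
    single integer \<open>2 ^ i\<close>, so additivity applies.\<close>
  have "of_nat (2 ^ i) * \<Phi> (axis i z) = \<Phi> (\<lambda>k. 2 ^ k * axis i z k)"
    unfolding Phi_of_nat_mult[symmetric] by (intro Phi_cong) auto
  also have "\<dots> = 2 ^ n * \<Phi> (axis i z)" by (rule Phi_dilation)
  finally have "of_nat (2 ^ n - 2 ^ i) * \<Phi> (axis i z) = of_nat (2 ^ n - 2 ^ i) * 0"
    using power_increasing[of i n "2 :: nat"] assms by (simp add: of_nat_diff algebra_simps)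
  moreover have "(2 :: nat) ^ n - 2 ^ i \<noteq> 0"
    using power_strict_increasing[of i n "2 :: nat"] assms by simp
  ultimately show ?thesis using of_nat_mult_cancel by blast
qed

text \<open>
  On the \<open>n\<close>-th axis \<open>P\<close> restricts to a one-variable polynomial; comparing its values at all natural
  multiples of a point leaves only the linear coefficient.
\<close>

lemma Phi_axis_top: "\<Phi> (axis n z) = z"
proof -
  \<comment> \<open>\<open>w\<close> is the \<open>n\<close>-th power sum of a point on the
    \<open>n\<close>-th axis whose \<open>n\<close>-th cumulant is \<open>z\<close>.\<close>
  define w where "w = unit_inv leading * z"
  have cw: "leading * w = z"
    using unit_inv[OF unit_leading] by (simp add: w_def flip: mult.assoc)
  \<comment> \<open>\<open>P\<close> may contain higher powers of the \<open>n\<close>-th variable;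
    \<open>N\<close> bounds their exponents and is at least 1 so that the linear term is
    included.\<close>
  obtain N where N: "\<And>m. m \<in> Poly_Mapping.keys P \<Longrightarrow> Poly_Mapping.lookup m n \<le> N" "1 \<le> N"
  proof
    let ?M = "Max (insert 1 ((\<lambda>m. Poly_Mapping.lookup m n) ` Poly_Mapping.keys P))"
    show "Poly_Mapping.lookup m n \<le> ?M" if "m \<in> Poly_Mapping.keys P" for m
      using that by (intro Max_ge) auto
    show "1 \<le> ?M" by (intro Max_ge) auto
  qed
  define b where "b k = Poly_Mapping.lookup P (Poly_Mapping.single n k) * w ^ k" for k
  define s where "s = \<Phi> (axis n z)"
  \<comment> \<open>The value at the axis point with cumulant \<open>j * z\<close> is computed
    twice: by \<open>P\<close> as a polynomial in \<open>j\<close>, and by additivity as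
    \<open>j\<close> times \<open>s\<close>.\<close>
  have *: "(\<Sum>k\<le>N. b k * of_nat j ^ k) = of_nat j * s" for j
  proof -
    let ?f = "with_cumulants (axis n (of_nat j * z))"
    have low: "cumulant t k ?f = 0" if "1 \<le> k" "k < n" for k
      using that by (simp add: with_cumulants)
    have "leading * power_sum ?f n = leading * (of_nat j * w)"
      using power_sum_if_lower_cumulants_0(2)[of ?f] low n_ge_1 cw
      by (simp add: with_cumulants mult.left_commute[of leading])
    then have top: "power_sum ?f n = of_nat j * w"
      using unit_leading unit_mult_cancel by blast
    have "of_nat j * s = \<Phi> (\<lambda>k. of_nat j * axis n z k)"
      unfolding s_def by (rule Phi_of_nat_mult[symmetric])
    also have "\<dots> = \<phi> ?f"
      using n_ge_1 by (intro Phi_eqI) (auto simp: with_cumulants)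
    also have "\<dots> = mpoly_eval P (axis n (of_nat j * w))"
      unfolding phi_eval[OF with_cumulants(1)]
    proof (rule mpoly_eval_cong)
      fix i assume "i \<in> mpoly_vars P"
      then have "1 \<le> i" "i \<le> n" using vars_P by auto
      then show "power_sum ?f i = axis n (of_nat j * w) i"
        using top power_sum_if_lower_cumulants_0(1)[OF with_cumulants(1) low, of i]
        by (cases "i = n") auto
    qed
    also have "\<dots> = (\<Sum>k\<le>N. b k * of_nat j ^ k)"
      using N(1) by (simp add: mpoly_eval_axis[of P n N] b_def power_mult_distrib mult_ac)
    finally show ?thesis by simp
  qed
  have "(\<Sum>k\<le>N. (b k - (if k = 1 then s else 0)) * of_nat j ^ k) = 0" for j
  proof -
    have "(\<Sum>k\<le>N. (if k = 1 then s else 0) * of_nat j ^ k) = (\<Sum>k\<le>N. if k = 1 then s * of_nat j else 0)"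
      by (intro sum.cong) auto
    also have "\<dots> = of_nat j * s"
      using N(2) by simp
    finally show ?thesis
      by (simp only: left_diff_distrib sum_subtractf *) simp
  qed
  from coeffs_zero_if_vanishes_on_nat[where k = 1, OF this N(2)] have "b 1 = s" by simp
  \<comment> \<open>The linear coefficient is \<open>leading * w\<close>, by the prescribed
    coefficient of \<open>P\<close>.\<close>
  moreover have "b 1 = z"
    using lookup_P cw by (simp add: b_def var_monom_def)
  ultimately show ?thesis by (simp add: s_def)
qed

lemma phi_eq_cumulant:
  assumes "f \<in> S"
  shows "\<phi> f = cumulant t n f"
proof -
  have "\<phi> f = \<Phi> (\<lambda>k. cumulant t k f)"
    using assms by (intro Phi_eqI[symmetric]) auto
  also have "\<dots> = (\<Sum>i\<in>{1..n}. if i = n then cumulant t n f else 0)"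
    unfolding Phi_eq_sum[of "\<lambda>k. cumulant t k f"]
    by (intro sum.cong) (auto simp: Phi_axis_lower Phi_axis_top)
  finally show ?thesis using n_ge_1 by simp
qed

end

section \<open>The full and the truncated instance\<close>

lemma free_convolution_UH:
  assumes "t \<in> Omega" "1 \<le> n"
  shows "free_convolution t n UH (boxplus t)"
proof
  show "\<exists>f\<in>UH. \<forall>k\<le>n. f k = a k" if "a 0 = 1" for a :: "nat \<Rightarrow> 'a"
    using that by (auto simp: UH_def)
qed (use assms in \<open>auto simp: Omega_def UH_def boxplus_0 dilation_def\<close>)

lemma free_convolution_UH_le:
  assumes "1 \<le> n" "n \<le> d"
  shows "free_convolution (of_nat d :: 'a::comm_rat_algebra_1) n (UH_le d) (boxplus_le d)"
proof
  \<comment> \<open>The sequence cut off at \<open>d\<close> still agrees with \<open>a\<close> up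
    to \<open>n\<close>, because \<open>n <= d\<close>.\<close>
  show "\<exists>f\<in>UH_le d. \<forall>k\<le>n. f k = a k" if "a 0 = 1" for a :: "nat \<Rightarrow> 'a"
    using that assms
    by (intro bexI[of _ "\<lambda>k. if k \<le> d then a k else 0"]) (auto simp: UH_le_def UH_def h_le_def)
qed (use assms in \<open>auto simp: UH_le_def UH_def h_le_def boxplus_le_def boxplus_0 dilation_def
      intro!: unit_falling_of_nat\<close>)

text \<open>The finite sum is already the whole series of \<open>E_map\<close>, because
  \<open>f\<close> vanishes beyond \<open>d\<close>.\<close>

lemma cumulant_le_eq:
  assumes "f \<in> UH_le d"
  shows "cumulant_le d n f = cumulant (of_nat d) n f"
proof -
  let ?c = "\<lambda>k. of_nat d ^ k * unit_inv (falling (of_nat d) k) * f k"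
  have "1 + (\<Sum>k=1..d. fps_const (?c k) * fps_X ^ k) = Abs_fps (E_map (of_nat d) f)"
  proof (rule fps_ext)
    fix j
    have "fps_nth (\<Sum>k=1..d. fps_const (?c k) * fps_X ^ k) j = (\<Sum>k=1..d. if k = j then ?c j else 0)"
      unfolding fps_sum_nth by (intro sum.cong) auto
    then show "fps_nth (1 + (\<Sum>k=1..d. fps_const (?c k) * fps_X ^ k)) j =
        fps_nth (Abs_fps (E_map (of_nat d) f)) j"
      using assms by (auto simp: E_map_def UH_le_def h_le_def not_le)
  qed
  then show ?thesis by (simp add: cumulant_le_def cumulant_def)
qed

theorem theorem3p3:
  shows
    "(\<forall>t :: 'a::comm_rat_algebra_1. t \<in> Omega \<longrightarrow> (\<forall>n\<ge>1.
        (\<exists>P :: 'a mpoly.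
            mpoly_vars P \<subseteq> {1..n}
          \<and> Poly_Mapping.lookup P (var_monom n) = t ^ (n - 1) * unit_inv (falling t n)
          \<and> (\<forall>m\<in>Poly_Mapping.keys P. m \<noteq> var_monom n \<longrightarrow> Poly_Mapping.keys m \<subseteq> {1..<n})
          \<and> (\<forall>f\<in>UH. cumulant t n f = mpoly_eval P (power_sum f)))
      \<and> (\<forall>r. \<forall>f\<in>UH. cumulant t n (dilation r f) = r ^ n * cumulant t n f)
      \<and> (\<forall>f\<in>UH. \<forall>g\<in>UH.
            cumulant t n (boxplus t f g) = cumulant t n f + cumulant t n g)
      \<and> (\<forall>\<phi> :: (nat \<Rightarrow> 'a) \<Rightarrow> 'a.
            (\<exists>P :: 'a mpoly.
                mpoly_vars P \<subseteq> {1..n}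
              \<and> Poly_Mapping.lookup P (var_monom n) = t ^ (n - 1) * unit_inv (falling t n)
              \<and> (\<forall>f\<in>UH. \<phi> f = mpoly_eval P (power_sum f)))
          \<and> (\<forall>r. \<forall>f\<in>UH. \<phi> (dilation r f) = r ^ n * \<phi> f)
          \<and> (\<forall>f\<in>UH. \<forall>g\<in>UH. \<phi> (boxplus t f g) = \<phi> f + \<phi> g)
          \<longrightarrow> (\<forall>f\<in>UH. \<phi> f = cumulant t n f))))
   \<and> (\<forall>d\<ge>1. \<forall>n. 1 \<le> n \<and> n \<le> d \<longrightarrow>
        (\<exists>P :: 'a mpoly.
            mpoly_vars P \<subseteq> {1..n}
          \<and> Poly_Mapping.lookup P (var_monom n) = of_nat d ^ (n - 1) * unit_inv (falling (of_nat d) n)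
          \<and> (\<forall>m\<in>Poly_Mapping.keys P. m \<noteq> var_monom n \<longrightarrow> Poly_Mapping.keys m \<subseteq> {1..<n})
          \<and> (\<forall>f\<in>UH_le d. cumulant_le d n f = mpoly_eval P (power_sum f)))
      \<and> (\<forall>r :: 'a. \<forall>f\<in>UH_le d. cumulant_le d n (dilation r f) = r ^ n * cumulant_le d n f)
      \<and> (\<forall>f\<in>(UH_le d :: (nat \<Rightarrow> 'a) set). \<forall>g\<in>UH_le d.
            cumulant_le d n (boxplus_le d f g) = cumulant_le d n f + cumulant_le d n g)
      \<and> (\<forall>\<phi> :: (nat \<Rightarrow> 'a) \<Rightarrow> 'a.
            (\<exists>P :: 'a mpoly.
                mpoly_vars P \<subseteq> {1..n}
              \<and> Poly_Mapping.lookup P (var_monom n) = of_nat d ^ (n - 1) * unit_inv (falling (of_nat d) n)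
              \<and> (\<forall>f\<in>UH_le d. \<phi> f = mpoly_eval P (power_sum f)))
          \<and> (\<forall>r. \<forall>f\<in>UH_le d. \<phi> (dilation r f) = r ^ n * \<phi> f)
          \<and> (\<forall>f\<in>UH_le d. \<forall>g\<in>UH_le d. \<phi> (boxplus_le d f g) = \<phi> f + \<phi> g)
          \<longrightarrow> (\<forall>f\<in>UH_le d. \<phi> f = cumulant_le d n f)))"
proof (intro conjI allI impI)
  fix t :: 'a and n :: nat
  assume tn: "t \<in> Omega" "1 \<le> n"
  interpret free_convolution t n UH "boxplus t"
    using tn by (rule free_convolution_UH)
  show "\<exists>P :: 'a mpoly. mpoly_vars P \<subseteq> {1..n}
      \<and> Poly_Mapping.lookup P (var_monom n) = t ^ (n - 1) * unit_inv (falling t n)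
      \<and> (\<forall>m\<in>Poly_Mapping.keys P. m \<noteq> var_monom n \<longrightarrow> Poly_Mapping.keys m \<subseteq> {1..<n})
      \<and> (\<forall>f\<in>UH. cumulant t n f = mpoly_eval P (power_sum f))"
    using cumulant_polynomial unfolding leading_def .
  show "\<forall>f\<in>UH. cumulant t n (dilation r f) = r ^ n * cumulant t n f" for r
    by (simp add: cumulant_dilation)
  show "\<forall>f\<in>UH. \<forall>g\<in>UH. cumulant t n (boxplus t f g) = cumulant t n f + cumulant t n g"
    by (simp add: cumulant_conv)
  fix \<phi> :: "(nat \<Rightarrow> 'a) \<Rightarrow> 'a"
  assume \<phi>: "(\<exists>P :: 'a mpoly.
          mpoly_vars P \<subseteq> {1..n}
        \<and> Poly_Mapping.lookup P (var_monom n) = t ^ (n - 1) * unit_inv (falling t n)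
        \<and> (\<forall>f\<in>UH. \<phi> f = mpoly_eval P (power_sum f)))
    \<and> (\<forall>r. \<forall>f\<in>UH. \<phi> (dilation r f) = r ^ n * \<phi> f)
    \<and> (\<forall>f\<in>UH. \<forall>g\<in>UH. \<phi> (boxplus t f g) = \<phi> f + \<phi> g)"
  then obtain P :: "'a mpoly" where "additive_functional t n UH (boxplus t) \<phi> P"
    unfolding additive_functional_def additive_functional_axioms_def leading_def
    using free_convolution_axioms by blast
  then show "\<forall>f\<in>UH. \<phi> f = cumulant t n f"
    using additive_functional.phi_eq_cumulant by blast
next
  fix d n :: nat
  assume dn: "1 \<le> d" "1 \<le> n \<and> n \<le> d"
  interpret free_convolution "of_nat d :: 'a" n "UH_le d" "boxplus_le d"
    using dn by (intro free_convolution_UH_le) auto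
  show "\<exists>P :: 'a mpoly. mpoly_vars P \<subseteq> {1..n}
      \<and> Poly_Mapping.lookup P (var_monom n) = of_nat d ^ (n - 1) * unit_inv (falling (of_nat d) n)
      \<and> (\<forall>m\<in>Poly_Mapping.keys P. m \<noteq> var_monom n \<longrightarrow> Poly_Mapping.keys m \<subseteq> {1..<n})
      \<and> (\<forall>f\<in>UH_le d. cumulant_le d n f = mpoly_eval P (power_sum f))"
    using cumulant_polynomial unfolding leading_def by (simp add: cumulant_le_eq)
  show "\<forall>f\<in>UH_le d. cumulant_le d n (dilation r f) = r ^ n * cumulant_le d n f" for r :: 'a
    by (simp add: cumulant_le_eq dilation_closed cumulant_dilation)
  show "\<forall>f\<in>(UH_le d :: (nat \<Rightarrow> 'a) set). \<forall>g\<in>UH_le d.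
      cumulant_le d n (boxplus_le d f g) = cumulant_le d n f + cumulant_le d n g"
    by (simp add: cumulant_le_eq conv_closed cumulant_conv)
  fix \<phi> :: "(nat \<Rightarrow> 'a) \<Rightarrow> 'a"
  assume \<phi>: "(\<exists>P :: 'a mpoly.
          mpoly_vars P \<subseteq> {1..n}
        \<and> Poly_Mapping.lookup P (var_monom n) = of_nat d ^ (n - 1) * unit_inv (falling (of_nat d) n)
        \<and> (\<forall>f\<in>UH_le d. \<phi> f = mpoly_eval P (power_sum f)))
    \<and> (\<forall>r. \<forall>f\<in>UH_le d. \<phi> (dilation r f) = r ^ n * \<phi> f)
    \<and> (\<forall>f\<in>UH_le d. \<forall>g\<in>UH_le d. \<phi> (boxplus_le d f g) = \<phi> f + \<phi> g)"
  then obtain P :: "'a mpoly" where "additive_functional (of_nat d) n (UH_le d) (boxplus_le d) \<phi> P"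
    unfolding additive_functional_def additive_functional_axioms_def leading_def
    using free_convolution_axioms by blast
  then show "\<forall>f\<in>UH_le d. \<phi> f = cumulant_le d n f"
    using additive_functional.phi_eq_cumulant by (simp add: cumulant_le_eq) blast
qed

end
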